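(* Let $\mathcal{G}=(\mathcal{V},\mathcal{F},\mathcal{E}\subseteq\mathcal{V}\times\mathcal{F})$ be an acyclic double-edge factor graph (without single edges) with alphabets $\{\mathcal{S}_j\}_{j\in\mathcal{V}}$ and local functions $\{f_a\}_{a\in\mathcal{F}}$. Then there exists a unique set of messages $\{m_{j\to a},\,m_{a\to j}:\mathcal{S}_j^2\to\mathbb{C}\}_{(j,a)\in\mathcal{E}}$ such that (for every $(j,a)\in\mathcal{E}$ and all $(s_j,\tilde s_j)\in\mathcal{S}_j^2$) $$m_{j\to a}(s_j,\tilde s_j)=\prod_{c\in\partial j\setminus a}m_{c\to j}(s_j,\tilde s_j),$$ $$m_{a\to j}(s_j,\tilde s_j)=\sum_{\boldsymbol{s}_{\partial a\setminus j},\,\tilde{\boldsymbol{s}}_{\partial a\setminus j}}f_a(\boldsymbol{s}_{\partial a},\tilde{\boldsymbol{s}}_{\partial a})\cdot\prod_{k\in\partial a\setminus j}m_{k\to a}(s_k,\tilde s_k).$$ Moreover, in this case, $$\sum_{\boldsymbol{s}_{\mathcal{V}\setminus j},\,\tilde{\boldsymbol{s}}_{\mathcal{V}\setminus j}}\ \prod_{a\in\mathcal{F}}f_a(\boldsymbol{s}_{\partial a},\tilde{\boldsymbol{s}}_{\partial a})=\prod_{c\in\partial j}m_{c\to j}(s_j,\tilde s_j)\qquad\forall j\in\mathcal{V},$$ $$\sum_{\boldsymbol{s}_{\mathcal{V}\setminus\partial a},\,\tilde{\boldsymbol{s}}_{\mathcal{V}\setminus\partial a}}\ \prod_{\hat a\in\mathcal{F}}f_{\hat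 a}(\boldsymbol{s}_{\partial\hat a},\tilde{\boldsymbol{s}}_{\partial\hat a})=f_a(\boldsymbol{s}_{\partial a},\tilde{\boldsymbol{s}}_{\partial a})\cdot\prod_{j\in\partial a}m_{j\to a}(s_j,\tilde s_j)\qquad\forall a\in\mathcal{F}.$$
   Context: A double-edge factor graph (DeFG) without single edges is a finite bipartite graph $\mathcal{G}=(\mathcal{V},\mathcal{F},\mathcal{E}\subseteq\mathcal{V}\times\mathcal{F})$ together with a set (alphabet) $\mathcal{S}_j$ for each $j\in\mathcal{V}$ and, for each $a\in\mathcal{F}$ with set of neighbors $\partial a\subseteq\mathcal{V}$, a function $f_a:\prod_{j\in\partial a}\mathcal{S}_j^2\to\mathbb{C}$, written $f_a(\boldsymbol{s}_{\partial a},\tilde{\boldsymbol{s}}_{\partial a})$ with $\boldsymbol{s}_{\partial a},\tilde{\boldsymbol{s}}_{\partial a}\in\prod_{j\in\partial a}\mathcal{S}_j$, such that the matrix with $(\boldsymbol{s}_{\partial a},\tilde{\boldsymbol{s}}_{\partial a})$-th entry $f_a(\boldsymbol{s}_{\partial a},\tilde{\boldsymbol{s}}_{\partial a})$ is positive semidefinite. $\partial j\subseteq\mathcal{F}$ denotes the set of neighbors of $j\in\mathcal{V}$. For $\mathcal{I}\subseteq\mathcal{V}$, $\boldsymbol{s}_{\mathcal{I}}=(s_j)_{j\in\mathcal{I}}$ and similarly $\tilde{\boldsymbol{s}}_{\mathcal{I}}$; sums run over all values in the corresponding alphabets. An empty product equals $1$. The identities between functions hold for all values of their free variables.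
   Formalization: The two "Moreover" identities are stated only for connected acyclic factor graphs; on a disconnected one the left-hand sides carry extra factors, the total sums of the other components, and the identities fail. Existence and uniqueness of the messages cover all acyclic graphs. *)

theory Defs
  imports Complex_Main "HOL-Library.FuncSet" "HOL-Library.Nonpos_Ints"
    "Graph_Theory.Graph_Theory"
begin

definition psd_matrix :: "'i set \<Rightarrow> ('i \<Rightarrow> 'i \<Rightarrow> complex) \<Rightarrow> bool" where
  "psd_matrix I M \<longleftrightarrow>
     (\<forall>s\<in>I. \<forall>t\<in>I. M t s = cnj (M s t)) \<and>
     (\<forall>x. (\<Sum>s\<in>I. \<Sum>t\<in>I. cnj (x s) * M s t * x t) \<in> \<real>\<^sub>\<ge>\<^sub>0)"

abbreviation fac_nbrs :: "('v \<times> 'f) set \<Rightarrow> 'v \<Rightarrow> 'f set" where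
  "fac_nbrs E j \<equiv> {a. (j, a) \<in> E}"

abbreviation var_nbrs :: "('v \<times> 'f) set \<Rightarrow> 'f \<Rightarrow> 'v set" where
  "var_nbrs E a \<equiv> {j. (j, a) \<in> E}"

text \<open>
  A configuration \<open>s\<close> of the variables in \<open>I\<close> is an element of \<open>PiE I S\<close>; it is
  \<open>undefined\<close> outside \<open>I\<close>. The alphabets \<open>S j\<close> are subsets of one type, and only the values of
  \<open>f a\<close> on \<open>PiE (var_nbrs E a) S\<close> are meaningful.
\<close>

locale double_edge_factor_graph =
  fixes V :: "'v set" and F :: "'f set" and E :: "('v \<times> 'f) set"
    and S :: "'v \<Rightarrow> 'a set"
    and f :: "'f \<Rightarrow> ('v \<Rightarrow> 'a) \<Rightarrow> ('v \<Rightarrow> 'a) \<Rightarrow> complex"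
  assumes finite_V: "finite V"
    and finite_F: "finite F"
    and edges: "E \<subseteq> V \<times> F"
    and finite_S: "\<And>j. j \<in> V \<Longrightarrow> finite (S j)"
    and psd: "\<And>a. a \<in> F \<Longrightarrow> psd_matrix (PiE (var_nbrs E a) S) (f a)"

text \<open>
  The undirected bipartite graph, represented as a digraph with both orientations of each edge.
\<close>

definition bip_graph ::
    "'v set \<Rightarrow> 'f set \<Rightarrow> ('v \<times> 'f) set \<Rightarrow> ('v + 'f) pair_pre_digraph" where
  "bip_graph V F E =
     \<lparr> pverts = V <+> F,
       parcs = (\<lambda>(j, a). (Inl j, Inr a)) ` E \<union> (\<lambda>(j, a). (Inr a, Inl j)) ` E \<rparr>"

text \<open>
  \<open>pre_digraph.cycle\<close> also accepts an edge followed by its own reversal, so the library's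
  \<open>forest\<close> fails for every symmetric digraph with an arc. A cycle of the underlying
  undirected simple graph is a cycle with at least three arcs.
\<close>

definition acyclic_bip :: "'v set \<Rightarrow> 'f set \<Rightarrow> ('v \<times> 'f) set \<Rightarrow> bool" where
  "acyclic_bip V F E \<longleftrightarrow>
     \<not> (\<exists>p. pre_digraph.cycle (with_proj (bip_graph V F E)) p \<and> 3 \<le> length p)"

text \<open>
  Connectedness is needed for the marginal identities: on a disconnected graph the left-hand
  sides carry the partition functions of the other components as additional factors.
\<close>

definition connected_bip :: "'v set \<Rightarrow> 'f set \<Rightarrow> ('v \<times> 'f) set \<Rightarrow> bool" where
  "connected_bip V F E \<longleftrightarrow> Digraph_Component.connected (with_proj (bip_graph V F E))"

text \<open>
  A family with one function on \<open>S j \<times> S j\<close> for each edge \<open>(j, a)\<close>. Extensionality makes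
  equality of families the same as equality on their domains.
\<close>

definition message_families ::
    "('v \<times> 'f) set \<Rightarrow> ('v \<Rightarrow> 'a set) \<Rightarrow> ('v \<times> 'f \<Rightarrow> 'a \<times> 'a \<Rightarrow> complex) set" where
  "message_families E S = PiE E (\<lambda>(j, a). PiE (S j \<times> S j) (\<lambda>_. UNIV))"

text \<open>
  \<open>m (j, a)\<close> is the message from \<open>j\<close> to \<open>a\<close>, and \<open>n (j, a)\<close> the message from \<open>a\<close> to \<open>j\<close>.
\<close>

definition message_equations ::
    "('v \<times> 'f) set \<Rightarrow> ('v \<Rightarrow> 'a set) \<Rightarrow> ('f \<Rightarrow> ('v \<Rightarrow> 'a) \<Rightarrow> ('v \<Rightarrow> 'a) \<Rightarrow> complex) \<Rightarrow>
     ('v \<times> 'f \<Rightarrow> 'a \<times> 'a \<Rightarrow> complex) \<Rightarrow> ('v \<times> 'f \<Rightarrow> 'a \<times> 'a \<Rightarrow> complex) \<Rightarrow> bool" where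
  "message_equations E S f m n \<longleftrightarrow>
     (\<forall>(j, a)\<in>E. \<forall>x\<in>S j. \<forall>y\<in>S j.
        m (j, a) (x, y) = (\<Prod>c\<in>fac_nbrs E j - {a}. n (j, c) (x, y)) \<and>
        n (j, a) (x, y) =
          (\<Sum>s\<in>PiE (var_nbrs E a - {j}) S. \<Sum>t\<in>PiE (var_nbrs E a - {j}) S.
             f a (s(j := x)) (t(j := y)) *
             (\<Prod>k\<in>var_nbrs E a - {j}. m (k, a) (s k, t k))))"

definition global_function ::
    "'f set \<Rightarrow> ('v \<times> 'f) set \<Rightarrow> ('f \<Rightarrow> ('v \<Rightarrow> 'a) \<Rightarrow> ('v \<Rightarrow> 'a) \<Rightarrow> complex) \<Rightarrow>
     ('v \<Rightarrow> 'a) \<Rightarrow> ('v \<Rightarrow> 'a) \<Rightarrow> complex" where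
  "global_function F E f s t =
     (\<Prod>a\<in>F. f a (restrict s (var_nbrs E a)) (restrict t (var_nbrs E a)))"

end

theory Submission
  imports Defs
begin

text \<open>
  The message along an arc depends only on messages along arcs that continue it backwards
  without turning around. An infinite chain of such dependencies in a finite graph revisits a
  node and so contains a cycle; in an acyclic graph the dependency is therefore well-founded,
  and well-founded recursion and induction give existence and uniqueness.

  For the marginals, take a connected subgraph \<open>(VT, FT)\<close> that contains all neighbours of
  its factors, multiply its local functions by the messages entering it, and sum over its
  variables outside the root set \<open>R\<close>. A factor next to the subgraph is attached to exactly
  one of its variables, as the graph is acyclic, so expanding the message of that factor adds
  the factor and its other neighbours without changing the sum. Starting from \<open>{j}\<close> or from
  \<open>a\<close> with its neighbours, this reaches the whole connected graph.
\<close>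

section \<open>Cycles of the bipartite graph as closed lists of vertices\<close>

lemma vwalk_arcs_awalk:
  assumes "xs \<noteq> []"
  shows "pcas (hd xs) (vwalk_arcs xs) (last xs)"
    and "pawalk_verts (hd xs) (vwalk_arcs xs) = xs"
  using assms by (induction xs rule: vwalk_arcs.induct) auto

lemma set_vwalk_arcs_subset_iff:
  "set (vwalk_arcs xs) \<subseteq> r \<longleftrightarrow> successively (\<lambda>x y. (x, y) \<in> r) xs"
  by (induction xs rule: vwalk_arcs.induct) auto

lemma length_vwalk_arcs: "length (vwalk_arcs xs) = length xs - 1"
  by (induction xs rule: vwalk_arcs.induct) auto

abbreviation bip_adj :: "'v set \<Rightarrow> 'f set \<Rightarrow> ('v \<times> 'f) set \<Rightarrow> ('v + 'f) rel" where
  "bip_adj V F E \<equiv> parcs (bip_graph V F E)"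

lemma bip_adj_iff [simp]:
  "(Inl j, Inr a) \<in> bip_adj V F E \<longleftrightarrow> (j, a) \<in> E"
  "(Inr a, Inl j) \<in> bip_adj V F E \<longleftrightarrow> (j, a) \<in> E"
  "(Inl j, Inl k) \<notin> bip_adj V F E"
  "(Inr a, Inr b) \<notin> bip_adj V F E"
  by (auto simp: bip_graph_def)

lemma sym_bip_adj: "sym (bip_adj V F E)"
  by (auto simp: bip_graph_def sym_def)

lemma irrefl_bip_adj: "(x, x) \<notin> bip_adj V F E"
  by (cases x) auto

lemma bip_adj_in_verts:
  assumes "E \<subseteq> V \<times> F" "(x, y) \<in> bip_adj V F E"
  shows "x \<in> V <+> F" "y \<in> V <+> F"
  using assms by (auto simp: bip_graph_def)

text \<open>Appending \<open>hd xs\<close> gives a closed vertex walk whose arc list is a cycle in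
  the library's sense, with as many arcs as \<open>xs\<close> has vertices. Later proofs use
  acyclicity only in this form.\<close>

lemma acyclic_bip_no_closed_path:
  assumes "acyclic_bip V F E" "E \<subseteq> V \<times> F"
    and "distinct xs" "3 \<le> length xs"
    and path: "successively (\<lambda>x y. (x, y) \<in> bip_adj V F E) xs"
    and closed: "(last xs, hd xs) \<in> bip_adj V F E"
  shows False
proof -
  let ?ys = "xs @ [hd xs]"
  have ne: "xs \<noteq> []" using assms(4) by auto
  have hd: "hd ?ys = hd xs" and last: "last ?ys = hd xs" using ne by auto
  have "successively (\<lambda>x y. (x, y) \<in> bip_adj V F E) ?ys"
    using path closed ne by (auto simp: successively_append_iff)
  then have "set (vwalk_arcs ?ys) \<subseteq> bip_adj V F E"
    by (simp only: set_vwalk_arcs_subset_iff)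
  moreover have "hd xs \<in> pverts (bip_graph V F E)"
    using bip_adj_in_verts(2)[OF assms(2) closed] by (simp add: bip_graph_def)
  ultimately have "pre_digraph.awalk (with_proj (bip_graph V F E)) (hd xs) (vwalk_arcs ?ys) (hd xs)"
    using vwalk_arcs_awalk(1)[of ?ys] hd last
    by (simp add: pre_digraph.awalk_def cas_with_proj_eq)
  moreover have "distinct (tl (pawalk_verts (hd xs) (vwalk_arcs ?ys)))"
    using vwalk_arcs_awalk(2)[of ?ys] hd \<open>distinct xs\<close> ne by (cases xs) auto
  moreover have "3 \<le> length (vwalk_arcs ?ys)"
    using assms(4) by (simp add: length_vwalk_arcs)
  ultimately have "pre_digraph.cycle (with_proj (bip_graph V F E)) (vwalk_arcs ?ys)"
    unfolding pre_digraph.cycle_def awalk_verts_with_proj_eq by fastforce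
  then show False
    using assms(1) \<open>3 \<le> length (vwalk_arcs ?ys)\<close> unfolding acyclic_bip_def by blast
qed

text \<open>A path is extended arc by arc; if the new endpoint already lies on it, the path is cut
  off there instead.\<close>

lemma rtrancl_imp_distinct_path:
  assumes "(x, y) \<in> r\<^sup>*"
  obtains xs where "xs \<noteq> []" "hd xs = x" "last xs = y" "distinct xs"
    "successively (\<lambda>x y. (x, y) \<in> r) xs"
proof -
  have "\<exists>xs. xs \<noteq> [] \<and> hd xs = x \<and> last xs = y \<and> distinct xs \<and> successively (\<lambda>x y. (x, y) \<in> r) xs"
    using assms
  proof (induction rule: rtrancl_induct)
    case base
    show ?case by (rule exI[of _ "[x]"]) simp
  next
    case (step y z)
    then obtain xs where xs: "xs \<noteq> []" "hd xs = x" "last xs = y" "distinct xs"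
      "successively (\<lambda>x y. (x, y) \<in> r) xs" by blast
    show ?case
    proof (cases "z \<in> set xs")
      case True
      then obtain as bs where "xs = as @ z # bs" by (meson split_list)
      then have "xs = (as @ [z]) @ bs" by simp
      moreover from this have "hd (as @ [z]) = x" using xs(2) by (metis hd_append snoc_eq_iff_butlast)
      ultimately have "hd (as @ [z]) = x \<and> distinct (as @ [z]) \<and>
          successively (\<lambda>x y. (x, y) \<in> r) (as @ [z])"
        using xs(4,5) distinct_append[of "as @ [z]" bs] successively_append_iff[of _ "as @ [z]" bs]
        by metis
      then show ?thesis by (intro exI[of _ "as @ [z]"]) simp
    next
      case False
      with xs step.hyps show ?thesis
        by (intro exI[of _ "xs @ [z]"]) (auto simp: successively_append_iff)
    qed
  qed
  then show ?thesis using that by blast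
qed

section \<open>Well-foundedness of the dependency between messages\<close>

text \<open>A pair \<open>(d, e)\<close> says that the message along the arc \<open>e\<close> reads
  the one along \<open>d\<close>. The condition \<open>x \<noteq> z\<close> mirrors the omission of
  the receiver in the products of the message equations.\<close>

definition message_dep :: "'n rel \<Rightarrow> ('n \<times> 'n) rel" where
  "message_dep r = {((x, y), (y, z)) |x y z. (x, y) \<in> r \<and> (y, z) \<in> r \<and> x \<noteq> z}"

lemma wf_message_dep:
  assumes "acyclic_bip V F E" "E \<subseteq> V \<times> F" "finite V" "finite F"
  shows "wf (message_dep (bip_adj V F E))"
  unfolding wf_iff_no_infinite_down_chain
proof
  assume "\<exists>e. \<forall>i. (e (Suc i), e i) \<in> message_dep (bip_adj V F E)"
  then obtain e where e: "\<And>i. (e (Suc i), e i) \<in> message_dep (bip_adj V F E)" by blast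
  \<comment> \<open>The heads of the arcs in the chain form a walk, traversed backwards, that never
    turns around (\<open>nb\<close>).\<close>
  define q where "q i = snd (e i)" for i
  have adj: "(q (Suc i), q i) \<in> bip_adj V F E" for i
    using e[of i] by (auto simp: message_dep_def q_def)
  have nb: "q (Suc (Suc i)) \<noteq> q i" for i
    using e[of i] e[of "Suc i"] by (auto simp: message_dep_def q_def)
  have "range q \<subseteq> V <+> F"
    using bip_adj_in_verts(2)[OF assms(2) adj] by auto
  then have "finite (range q)"
    by (rule finite_subset) (use assms(3,4) in simp)
  then have "\<not> inj q" using finite_imageD infinite_UNIV_nat by blast
  then have "\<exists>j. \<exists>i<j. q i = q j"
    unfolding inj_def by (metis linorder_neqE_nat)
  \<comment> \<open>Taking the first index \<open>j\<close> whose node occurred before makes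
    \<open>q\<close> injective on \<open>{i..<j}\<close>, so this segment is a path, closed by
    \<open>q j = q i\<close>.\<close>
  then obtain j where "\<exists>i<j. q i = q j" and least: "\<And>l. l < j \<Longrightarrow> \<not> (\<exists>i<l. q i = q l)"
    using exists_least_iff[of "\<lambda>j. \<exists>i<j. q i = q j"] by blast
  then obtain i where i: "i < j" "q i = q j" by blast
  \<comment> \<open>Distance 1 between the repeated nodes would be a loop and distance 2 a reversal,
    so the segment has at least three nodes.\<close>
  have "j \<noteq> Suc i" using i adj[of i] irrefl_bip_adj[of "q i" V F E] by auto
  moreover have "j \<noteq> Suc (Suc i)" using i nb[of i] by auto
  ultimately have len: "i + 3 \<le> j" using i by linarith
  let ?xs = "map q [i..<j]"
  have "inj_on q {i..<j}"
    using least by (intro linorder_inj_onI) (force, linarith)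
  then have "distinct ?xs" by (simp add: distinct_map)
  moreover have "successively (\<lambda>x y. (x, y) \<in> bip_adj V F E) ?xs"
    using symD[OF sym_bip_adj adj] by (auto simp: successively_conv_nth)
  moreover have "(last ?xs, hd ?xs) \<in> bip_adj V F E"
    using i adj[of "j - 1"] symD[OF sym_bip_adj] by (auto simp: last_map hd_map)
  ultimately show False
    using acyclic_bip_no_closed_path[OF assms(1,2)] len by fastforce
qed

section \<open>Connected subgraphs of an acyclic graph\<close>

text \<open>The library's connectedness refers to the symmetric closure of the arcs; as both
  orientations of each edge are present, this closure adds nothing.\<close>

lemma connected_bip_reachable:
  assumes "connected_bip V F E" "x \<in> V <+> F" "y \<in> V <+> F"
  shows "(x, y) \<in> (bip_adj V F E)\<^sup>*"
proof -
  let ?G = "with_proj (bip_graph V F E)"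
  have "x \<rightarrow>\<^sup>*\<^bsub>with_proj (mk_symmetric ?G)\<^esub> y"
    using assms by (auto simp: connected_bip_def connected_def strongly_connected_def bip_graph_def)
  then have "(x, y) \<in> (parcs (mk_symmetric ?G))\<^sup>*"
    by (simp add: reachable_def rtrancl_on_rtranclI)
  moreover have "parcs (mk_symmetric ?G) = bip_adj V F E"
    using sym_bip_adj[of V F E] by (fastforce simp: parcs_mk_symmetric sym_def)
  ultimately show ?thesis by simp
qed

text \<open>A second edge from \<open>c\<close> into a connected set would close a cycle.\<close>

lemma acyclic_bip_unique_nbr:
  assumes "acyclic_bip V F E" "E \<subseteq> V \<times> F"
    and "\<And>x y. x \<in> W \<Longrightarrow> y \<in> W \<Longrightarrow> (x, y) \<in> (bip_adj V F E \<inter> W \<times> W)\<^sup>*"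
    and "Inr c \<notin> W" "Inl j \<in> W" "Inl k \<in> W" "(j, c) \<in> E" "(k, c) \<in> E"
  shows "j = k"
proof (rule ccontr)
  assume "j \<noteq> k"
  let ?r = "bip_adj V F E \<inter> W \<times> W"
  obtain xs where xs: "xs \<noteq> []" "hd xs = Inl j" "last xs = Inl k" "distinct xs"
    "successively (\<lambda>x y. (x, y) \<in> ?r) xs"
    using rtrancl_imp_distinct_path[OF assms(3)[OF assms(5,6)]] by metis
  obtain ys where ys: "xs = Inl j # ys" using xs(1,2) by (cases xs) auto
  with xs(3) \<open>j \<noteq> k\<close> have "ys \<noteq> []" by auto
  \<comment> \<open>Every vertex of the path except the last is the source of an arc of
    \<open>?r\<close>, and the last is \<open>Inl k\<close>.\<close>
  have "set xs \<subseteq> W"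
  proof
    fix x assume "x \<in> set xs"
    then obtain as bs where *: "xs = as @ x # bs" by (meson split_list)
    show "x \<in> W"
    proof (cases bs)
      case Nil
      then show ?thesis using * xs(3) assms(6) by auto
    next
      case (Cons b bs')
      then show ?thesis using * xs(5) by (auto simp: successively_append_iff)
    qed
  qed
  then have "distinct (xs @ [Inr c])" using xs(4) assms(4) by auto
  moreover have "3 \<le> length (xs @ [Inr c])" using ys \<open>ys \<noteq> []\<close> by (cases ys) auto
  moreover have "successively (\<lambda>x y. (x, y) \<in> bip_adj V F E) xs"
    using xs(5) by (rule successively_mono) auto
  then have "successively (\<lambda>x y. (x, y) \<in> bip_adj V F E) (xs @ [Inr c])"
    using xs(3) assms(8) by (auto simp: successively_append_iff)
  moreover have "(last (xs @ [Inr c]), hd (xs @ [Inr c])) \<in> bip_adj V F E"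
    using xs(1,2) assms(7) by auto
  ultimately show False using acyclic_bip_no_closed_path[OF assms(1,2)] by blast
qed

section \<open>Sums over configurations of disjoint sets of variables\<close>

text \<open>Restriction to \<open>A\<close> and \<open>B\<close> and gluing with
  \<open>override_on\<close> are inverse bijections between configurations on the union and pairs of
  configurations.\<close>

lemma sum_PiE_Un:
  assumes "A \<inter> B = {}"
  shows "(\<Sum>s\<in>PiE (A \<union> B) S. g s) = (\<Sum>s\<in>PiE A S. \<Sum>t\<in>PiE B S. g (override_on s t B))"
proof -
  have "(\<Sum>s\<in>PiE (A \<union> B) S. g s) = (\<Sum>(s, t)\<in>PiE A S \<times> PiE B S. g (override_on s t B))"
    using assms
    by (intro sum.reindex_bij_witness[where j = "\<lambda>s. (restrict s A, restrict s B)"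
          and i = "\<lambda>(s, t). override_on s t B"])
       (auto simp: override_on_def PiE_iff extensional_def fun_eq_iff restrict_def disjoint_iff
         intro!: arg_cong[where f = g] split: if_splits)
  then show ?thesis by (simp add: sum.cartesian_product)
qed

text \<open>Exchanging the two middle sums puts the sums over \<open>B\<close> innermost, where the
  sum of a message equation can be recognised.\<close>

lemma sum_sum_PiE_Un:
  assumes "A \<inter> B = {}"
  shows "(\<Sum>s\<in>PiE (A \<union> B) S. \<Sum>t\<in>PiE (A \<union> B) S. g s t) =
    (\<Sum>s\<in>PiE A S. \<Sum>t\<in>PiE A S. \<Sum>s'\<in>PiE B S. \<Sum>t'\<in>PiE B S.
       g (override_on s s' B) (override_on t t' B))"
  unfolding sum_PiE_Un[OF assms]
  by (intro sum.cong refl sum.swap)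


section \<open>Existence and uniqueness of the messages\<close>

lemma message_equationsD:
  assumes "message_equations E S f m n" "(j, a) \<in> E" "x \<in> S j" "y \<in> S j"
  shows "m (j, a) (x, y) = (\<Prod>c\<in>fac_nbrs E j - {a}. n (j, c) (x, y))"
    and "n (j, a) (x, y) =
      (\<Sum>s\<in>PiE (var_nbrs E a - {j}) S. \<Sum>t\<in>PiE (var_nbrs E a - {j}) S.
         f a (s(j := x)) (t(j := y)) * (\<Prod>k\<in>var_nbrs E a - {j}. m (k, a) (s k, t k)))"
  using assms unfolding message_equations_def by blast+

text \<open>
  Both kinds of messages as one function on the arcs of the bipartite graph, so that the
  message equations become a recursion along \<^const>\<open>message_dep\<close>.
\<close>

fun message_step ::
    "('v \<times> 'f) set \<Rightarrow> ('v \<Rightarrow> 'a set) \<Rightarrow> ('f \<Rightarrow> ('v \<Rightarrow> 'a) \<Rightarrow> ('v \<Rightarrow> 'a) \<Rightarrow> complex) \<Rightarrow>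
     (('v + 'f) \<times> ('v + 'f) \<Rightarrow> 'a \<times> 'a \<Rightarrow> complex) \<Rightarrow>
     ('v + 'f) \<times> ('v + 'f) \<Rightarrow> 'a \<times> 'a \<Rightarrow> complex" where
  "message_step E S f M (Inl j, Inr a) =
     (if (j, a) \<in> E
      then restrict (\<lambda>(x, y). \<Prod>c\<in>fac_nbrs E j - {a}. M (Inr c, Inl j) (x, y)) (S j \<times> S j)
      else undefined)"
| "message_step E S f M (Inr a, Inl j) =
     (if (j, a) \<in> E
      then restrict (\<lambda>(x, y).
        \<Sum>s\<in>PiE (var_nbrs E a - {j}) S. \<Sum>t\<in>PiE (var_nbrs E a - {j}) S.
          f a (s(j := x)) (t(j := y)) *
          (\<Prod>k\<in>var_nbrs E a - {j}. M (Inl k, Inr a) (s k, t k))) (S j \<times> S j)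
      else undefined)"
| "message_step E S f M _ = undefined"

lemma adm_wf_message_step: "adm_wf (message_dep (bip_adj V F E)) (message_step E S f)"
proof -
  have "message_step E S f M e = message_step E S f N e"
    if dep: "\<And>d. (d, e) \<in> message_dep (bip_adj V F E) \<Longrightarrow> M d = N d" for M N e
  proof -
    consider (to_fac) j a where "e = (Inl j, Inr a)" "(j, a) \<in> E"
      | (to_var) j a where "e = (Inr a, Inl j)" "(j, a) \<in> E"
      | (none) "\<And>j a. (j, a) \<in> E \<Longrightarrow> e \<noteq> (Inl j, Inr a) \<and> e \<noteq> (Inr a, Inl j)"
      by blast
    then show ?thesis
    proof cases
      case to_fac
      then have "M (Inr c, Inl j) = N (Inr c, Inl j)" if "c \<in> fac_nbrs E j - {a}" for c
        using that by (intro dep) (auto simp: message_dep_def)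
      with to_fac show ?thesis by (auto intro!: restrict_ext prod.cong)
    next
      case to_var
      then have "M (Inl k, Inr a) = N (Inl k, Inr a)" if "k \<in> var_nbrs E a - {j}" for k
        using that by (intro dep) (auto simp: message_dep_def)
      with to_var show ?thesis
        by (auto intro!: restrict_ext sum.cong prod.cong arg_cong2[where f = times])
    next
      \<comment> \<open>Admissibility concerns all pairs of nodes; on those that are not arcs the
        step is \<open>undefined\<close> whatever \<open>M\<close> is.\<close>
      case none
      then show ?thesis
        by (cases "(E, S, f, M, e)" rule: message_step.cases) auto
    qed
  qed
  then show ?thesis unfolding adm_wf_def by blast
qed

text \<open>Well-founded recursion solves \<open>M = message_step E S f M\<close>, and
  \<open>m\<close> and \<open>n\<close> are the values of \<open>M\<close> on the two orientations
  of the edges. The \<open>undefined\<close> branches of \<open>message_step\<close> and its use of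
  \<open>restrict\<close> make both families extensional.\<close>

lemma messages_exist:
  assumes "wf (message_dep (bip_adj V F E))"
  obtains m n where "m \<in> message_families E S" "n \<in> message_families E S"
    "message_equations E S f m n"
proof -
  define M where "M = wfrec (message_dep (bip_adj V F E)) (message_step E S f)"
  have M: "M e = message_step E S f M e" for e
    unfolding M_def using wfrec_fixpoint[OF assms adm_wf_message_step] by metis
  define m where "m = (\<lambda>(j, a). M (Inl j, Inr a))"
  define n where "n = (\<lambda>(j, a). M (Inr a, Inl j))"
  have m: "m (j, a) = message_step E S f M (Inl j, Inr a)" for j a
    unfolding m_def by (simp only: prod.case, rule M)
  have n: "n (j, a) = message_step E S f M (Inr a, Inl j)" for j a
    unfolding n_def by (simp only: prod.case, rule M)
  have "m \<in> message_families E S" "n \<in> message_families E S"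
    unfolding message_families_def by (auto simp: m n PiE_iff extensional_def split: if_splits)
  moreover have "message_equations E S f m n"
    unfolding message_equations_def
  proof (clarify, intro conjI)
    fix j a x y assume "(j, a) \<in> E" "x \<in> S j" "y \<in> S j"
    then show "m (j, a) (x, y) = (\<Prod>c\<in>fac_nbrs E j - {a}. n (j, c) (x, y))"
      unfolding m by (simp add: n_def)
    from \<open>(j, a) \<in> E\<close> \<open>x \<in> S j\<close> \<open>y \<in> S j\<close> show "n (j, a) (x, y) =
        (\<Sum>s\<in>PiE (var_nbrs E a - {j}) S. \<Sum>t\<in>PiE (var_nbrs E a - {j}) S.
           f a (s(j := x)) (t(j := y)) * (\<Prod>k\<in>var_nbrs E a - {j}. m (k, a) (s k, t k)))"
      unfolding n by (simp add: m_def)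
  qed
  ultimately show ?thesis using that by blast
qed

lemma message_families_eqI:
  assumes "m \<in> message_families E S" "m' \<in> message_families E S"
    and "\<And>j a x y. (j, a) \<in> E \<Longrightarrow> x \<in> S j \<Longrightarrow> y \<in> S j \<Longrightarrow> m (j, a) (x, y) = m' (j, a) (x, y)"
  shows "m = m'"
proof (rule PiE_ext)
  show "m \<in> PiE E (\<lambda>(j, a). PiE (S j \<times> S j) (\<lambda>_. UNIV))"
    "m' \<in> PiE E (\<lambda>(j, a). PiE (S j \<times> S j) (\<lambda>_. UNIV))"
    using assms(1,2) by (auto simp: message_families_def)
  fix e assume "e \<in> E"
  obtain j a where e: "e = (j, a)" by (cases e)
  have "m e \<in> PiE (S j \<times> S j) (\<lambda>_. UNIV)" "m' e \<in> PiE (S j \<times> S j) (\<lambda>_. UNIV)"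
    using assms(1,2) \<open>e \<in> E\<close> e by (auto simp: message_families_def PiE_iff)
  then show "m e = m' e"
    by (rule PiE_ext) (use assms(3) \<open>e \<in> E\<close> e in auto)
qed

lemma messages_unique:
  assumes "wf (message_dep (bip_adj V F E))"
    and "m \<in> message_families E S" "n \<in> message_families E S"
    and eqs: "message_equations E S f m n"
    and "m' \<in> message_families E S" "n' \<in> message_families E S"
    and eqs': "message_equations E S f m' n'"
  shows "m = m' \<and> n = n'"
proof -
  \<comment> \<open>Each kind of message depends on the other, so both enter one statement about an
    arc \<open>e\<close>, proved by induction along \<open>message_dep\<close>.\<close>
  have *: "(\<forall>j a. e = (Inl j, Inr a) \<longrightarrow> (j, a) \<in> E \<longrightarrow>
        (\<forall>x\<in>S j. \<forall>y\<in>S j. m (j, a) (x, y) = m' (j, a) (x, y))) \<and>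
      (\<forall>j a. e = (Inr a, Inl j) \<longrightarrow> (j, a) \<in> E \<longrightarrow>
        (\<forall>x\<in>S j. \<forall>y\<in>S j. n (j, a) (x, y) = n' (j, a) (x, y)))" for e
    using assms(1)
  proof (induction e rule: wf_induct_rule)
    case (less e)
    show ?case
    proof (intro conjI allI impI ballI)
      fix j a x y assume e: "e = (Inl j, Inr a)" "(j, a) \<in> E" and xy: "x \<in> S j" "y \<in> S j"
      have "n (j, c) (x, y) = n' (j, c) (x, y)" if "c \<in> fac_nbrs E j - {a}" for c
        using less[of "(Inr c, Inl j)"] that e xy by (auto simp: message_dep_def)
      then show "m (j, a) (x, y) = m' (j, a) (x, y)"
        using message_equationsD(1)[OF eqs e(2) xy] message_equationsD(1)[OF eqs' e(2) xy]
        by simp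
    next
      fix j a x y assume e: "e = (Inr a, Inl j)" "(j, a) \<in> E" and xy: "x \<in> S j" "y \<in> S j"
      have "m (k, a) (s k, t k) = m' (k, a) (s k, t k)"
        if "k \<in> var_nbrs E a - {j}" "s \<in> PiE (var_nbrs E a - {j}) S"
          "t \<in> PiE (var_nbrs E a - {j}) S" for k s t
        using less[of "(Inl k, Inr a)"] that e PiE_mem[OF that(2,1)] PiE_mem[OF that(3,1)]
        by (auto simp: message_dep_def)
      then show "n (j, a) (x, y) = n' (j, a) (x, y)"
        unfolding message_equationsD(2)[OF eqs e(2) xy] message_equationsD(2)[OF eqs' e(2) xy]
        by (intro sum.cong prod.cong arg_cong2[where f = times] refl) auto
    qed
  qed
  show ?thesis
    using * assms by (intro conjI message_families_eqI) auto
qed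

section \<open>Marginals by growing a connected subgraph\<close>

text \<open>The quantity kept constant during the growth. \<open>u\<close> and \<open>w\<close> fix
  the variables in \<open>R\<close>, and each edge from \<open>VT\<close> to a factor outside
  \<open>FT\<close> carries the message standing for what lies behind it. On the whole graph no such
  edge is left and a marginal of the global function remains.\<close>

definition partial_marginal ::
    "('v \<times> 'f) set \<Rightarrow> ('v \<Rightarrow> 'a set) \<Rightarrow> ('f \<Rightarrow> ('v \<Rightarrow> 'a) \<Rightarrow> ('v \<Rightarrow> 'a) \<Rightarrow> complex) \<Rightarrow>
     ('v \<times> 'f \<Rightarrow> 'a \<times> 'a \<Rightarrow> complex) \<Rightarrow> 'v set \<Rightarrow> ('v \<Rightarrow> 'a) \<Rightarrow> ('v \<Rightarrow> 'a) \<Rightarrow>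
     'v set \<Rightarrow> 'f set \<Rightarrow> complex" where
  "partial_marginal E S f n R u w VT FT =
     (\<Sum>s\<in>PiE (VT - R) S. \<Sum>t\<in>PiE (VT - R) S.
        global_function FT E f (override_on s u R) (override_on t w R) *
        (\<Prod>(k, c)\<in>{(k, c)\<in>E. k \<in> VT \<and> c \<notin> FT}.
           n (k, c) (override_on s u R k, override_on t w R k)))"

lemma override_on_in_alphabet:
  assumes "s \<in> PiE (A - R) S" "\<forall>j\<in>R. u j \<in> S j" "j \<in> A"
  shows "override_on s u R j \<in> S j"
  using assms by (auto simp: override_on_def PiE_iff)

text \<open>Read from right to left, the equation for \<open>n (k, c)\<close> expands the message on
  the edge to \<open>c\<close>; the messages \<open>m (k', c)\<close> in it are products of the
  messages on the edges that become the new boundary.\<close>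

lemma partial_marginal_step:
  assumes "finite E" "finite FT"
    and eqs: "message_equations E S f m n"
    and R: "R \<subseteq> VT" "\<forall>j\<in>R. u j \<in> S j" "\<forall>j\<in>R. w j \<in> S j"
    and nbrs: "\<And>a. a \<in> FT \<Longrightarrow> var_nbrs E a \<subseteq> VT"
    and c: "c \<notin> FT" "(k, c) \<in> E" "var_nbrs E c \<inter> VT = {k}"
  shows "partial_marginal E S f n R u w (VT \<union> var_nbrs E c) (insert c FT) =
    partial_marginal E S f n R u w VT FT"
proof -
  define B where "B = var_nbrs E c - {k}"
  have B: "B \<inter> VT = {}" "k \<in> VT" "var_nbrs E c = insert k B" "k \<notin> B"
    using c by (auto simp: B_def)
  \<comment> \<open>\<open>bd\<close> is the part of the boundary that stays, \<open>bd'\<close> the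
    part that \<open>c\<close> brings in. In \<open>bd'\<close> the condition
    \<open>c' \<noteq> c\<close> suffices, since factors in \<open>FT\<close> have all their
    neighbours in \<open>VT\<close>, which is disjoint from \<open>B\<close>.\<close>
  define bd where "bd = {(k', c')\<in>E. k' \<in> VT \<and> c' \<notin> FT} - {(k, c)}"
  define bd' where "bd' = {(k', c')\<in>E. k' \<in> B \<and> c' \<noteq> c}"
  have fin: "finite bd" "finite bd'" "finite B"
  proof -
    show "finite bd" "finite bd'"
      using \<open>finite E\<close> by (auto simp: bd_def bd'_def intro: rev_finite_subset)
    have "B \<subseteq> fst ` E" by (force simp: B_def)
    then show "finite B" using \<open>finite E\<close> finite_surj by blast
  qed
  have bd_old: "{(k', c')\<in>E. k' \<in> VT \<and> c' \<notin> FT} = insert (k, c) bd" "(k, c) \<notin> bd"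
    using c(1,2) B(2) by (auto simp: bd_def)
  have bd_new: "{(k', c')\<in>E. k' \<in> VT \<union> var_nbrs E c \<and> c' \<notin> insert c FT} = bd \<union> bd'"
    "bd \<inter> bd' = {}"
    using B nbrs c by (auto simp: bd_def bd'_def)
  have bd'_Sigma: "bd' = Sigma B (\<lambda>k'. fac_nbrs E k' - {c})"
    by (auto simp: bd'_def)
  have fac_fin: "finite (fac_nbrs E k')" for k'
    using \<open>finite E\<close> by (rule finite_surj[of _ _ snd]) force
  let ?ovs = "\<lambda>s. override_on s u R" and ?ovt = "\<lambda>t. override_on t w R"
  define bdp where "bdp s t = (\<Prod>(k', c')\<in>bd. n (k', c') (?ovs s k', ?ovt t k'))" for s t
  define glob where "glob s t = global_function FT E f (?ovs s) (?ovt t)" for s t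
  \<comment> \<open>At a glued configuration the summand splits into a part that depends on
    \<open>s\<close> and \<open>t\<close> alone and the summand of the equation for
    \<open>n (k, c)\<close>.\<close>
  have factorise: "global_function (insert c FT) E f (?ovs (override_on s s' B)) (?ovt (override_on t t' B)) *
        (\<Prod>(k', c')\<in>bd \<union> bd'.
           n (k', c') (?ovs (override_on s s' B) k', ?ovt (override_on t t' B) k')) =
      glob s t * bdp s t * (f c (s'(k := ?ovs s k)) (t'(k := ?ovt t k)) *
        (\<Prod>k'\<in>B. m (k', c) (s' k', t' k')))"
    if s': "s' \<in> PiE B S" and t': "t' \<in> PiE B S" for s t s' t'
  proof -
    \<comment> \<open>\<open>R\<close> lies in \<open>VT\<close> and so avoids \<open>B\<close>: the
      fixed values never overwrite those of \<open>s'\<close> and \<open>t'\<close>.\<close>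
    have ov: "?ovs (override_on s s' B) j = (if j \<in> B then s' j else ?ovs s j)"
      "?ovt (override_on t t' B) j = (if j \<in> B then t' j else ?ovt t j)" for j
      using B R by (auto simp: override_on_def)
    have fc: "restrict (?ovs (override_on s s' B)) (var_nbrs E c) = s'(k := ?ovs s k)"
      "restrict (?ovt (override_on t t' B)) (var_nbrs E c) = t'(k := ?ovt t k)"
      unfolding B(3) using s' t' B(4) by (auto simp: fun_eq_iff ov PiE_iff extensional_def)
    have "global_function FT E f (?ovs (override_on s s' B)) (?ovt (override_on t t' B)) = glob s t"
      unfolding glob_def global_function_def
    proof (intro prod.cong refl arg_cong2[where f = "f _"] restrict_ext)
      fix a j assume "a \<in> FT" "j \<in> var_nbrs E a"
      then have "j \<notin> B" using nbrs B(1) by blast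
      then show "?ovs (override_on s s' B) j = ?ovs s j" "?ovt (override_on t t' B) j = ?ovt t j"
        by (simp_all add: ov)
    qed
    then have glob: "global_function (insert c FT) E f (?ovs (override_on s s' B))
        (?ovt (override_on t t' B)) = f c (s'(k := ?ovs s k)) (t'(k := ?ovt t k)) * glob s t"
      using \<open>finite FT\<close> c(1) fc by (simp add: global_function_def)
    have old: "(\<Prod>(k', c')\<in>bd. n (k', c') (?ovs (override_on s s' B) k', ?ovt (override_on t t' B) k'))
        = bdp s t"
      unfolding bdp_def
    proof (intro prod.cong refl, clarify)
      fix k' c' assume "(k', c') \<in> bd"
      then have "k' \<notin> B" using B(1) by (auto simp: bd_def)
      then show "n (k', c') (?ovs (override_on s s' B) k', ?ovt (override_on t t' B) k') =
          n (k', c') (?ovs s k', ?ovt t k')"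
        by (simp add: ov)
    qed
    have "(\<Prod>(k', c')\<in>bd'. n (k', c') (?ovs (override_on s s' B) k', ?ovt (override_on t t' B) k'))
        = (\<Prod>(k', c')\<in>bd'. n (k', c') (s' k', t' k'))"
      by (intro prod.cong refl) (auto simp: ov bd'_def)
    \<comment> \<open>Grouping the new boundary edges by their variable produces the right-hand
      sides of the equations for \<open>m (k', c)\<close>.\<close>
    also have "\<dots> = (\<Prod>k'\<in>B. \<Prod>c'\<in>fac_nbrs E k' - {c}. n (k', c') (s' k', t' k'))"
      unfolding bd'_Sigma using fin(3) fac_fin by (intro prod.Sigma[symmetric]) auto
    also have "\<dots> = (\<Prod>k'\<in>B. m (k', c) (s' k', t' k'))"
    proof (intro prod.cong refl)
      fix k' assume "k' \<in> B"
      then show "(\<Prod>c'\<in>fac_nbrs E k' - {c}. n (k', c') (s' k', t' k')) = m (k', c) (s' k', t' k')"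
        using message_equationsD(1)[OF eqs, of k' c "s' k'" "t' k'"] s' t'
        by (auto simp: B_def PiE_iff)
    qed
    finally show ?thesis
      using glob old fin bd_new(2) by (simp add: prod.union_disjoint mult_ac)
  qed
  have un: "VT \<union> var_nbrs E c - R = (VT - R) \<union> B" "(VT - R) \<inter> B = {}"
    using B R(1) by auto
  have "partial_marginal E S f n R u w (VT \<union> var_nbrs E c) (insert c FT) =
      (\<Sum>s\<in>PiE (VT - R) S. \<Sum>t\<in>PiE (VT - R) S. \<Sum>s'\<in>PiE B S. \<Sum>t'\<in>PiE B S.
        glob s t * bdp s t * (f c (s'(k := ?ovs s k)) (t'(k := ?ovt t k)) *
        (\<Prod>k'\<in>B. m (k', c) (s' k', t' k'))))"
    unfolding partial_marginal_def un(1) sum_sum_PiE_Un[OF un(2)] bd_new(1)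
    by (intro sum.cong refl factorise)
  also have "\<dots> = (\<Sum>s\<in>PiE (VT - R) S. \<Sum>t\<in>PiE (VT - R) S.
      glob s t * bdp s t * n (k, c) (?ovs s k, ?ovt t k))"
  proof (intro sum.cong refl)
    fix s t assume s: "s \<in> PiE (VT - R) S" and t: "t \<in> PiE (VT - R) S"
    show "(\<Sum>s'\<in>PiE B S. \<Sum>t'\<in>PiE B S.
        glob s t * bdp s t * (f c (s'(k := ?ovs s k)) (t'(k := ?ovt t k)) *
        (\<Prod>k'\<in>B. m (k', c) (s' k', t' k')))) = glob s t * bdp s t * n (k, c) (?ovs s k, ?ovt t k)"
      unfolding message_equationsD(2)[OF eqs c(2) override_on_in_alphabet[OF s R(2) B(2)]
          override_on_in_alphabet[OF t R(3) B(2)]] B_def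
      by (simp add: sum_distrib_left)
  qed
  also have "\<dots> = partial_marginal E S f n R u w VT FT"
    unfolding partial_marginal_def bd_old(1)
    using fin(1) bd_old(2) by (simp add: glob_def bdp_def mult_ac)
  finally show ?thesis .
qed

text \<open>Induction on the number of factors outside the subgraph: a factor across a boundary edge
  is absorbed while there is one. Without boundary edges the subgraph is closed under adjacency,
  hence is the whole connected graph, and the product of messages is empty.\<close>

lemma partial_marginal_eq_marginal:
  assumes "acyclic_bip V F E" "connected_bip V F E" "E \<subseteq> V \<times> F" "finite V" "finite F"
    and eqs: "message_equations E S f m n"
    and "VT \<subseteq> V" "FT \<subseteq> F" "VT <+> FT \<noteq> {}"
    and R: "R \<subseteq> VT" "\<forall>j\<in>R. u j \<in> S j" "\<forall>j\<in>R. w j \<in> S j"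
    and "\<And>a. a \<in> FT \<Longrightarrow> var_nbrs E a \<subseteq> VT"
    and "\<And>x y. x \<in> VT <+> FT \<Longrightarrow> y \<in> VT <+> FT \<Longrightarrow>
      (x, y) \<in> (bip_adj V F E \<inter> (VT <+> FT) \<times> (VT <+> FT))\<^sup>*"
  shows "partial_marginal E S f n R u w VT FT =
    (\<Sum>s\<in>PiE (V - R) S. \<Sum>t\<in>PiE (V - R) S.
       global_function F E f (override_on s u R) (override_on t w R))"
  using assms(7-)
proof (induction "card (F - FT)" arbitrary: VT FT rule: less_induct)
  case less
  let ?W = "VT <+> FT"
  have finE: "finite E" using assms(3-5) finite_subset by blast
  show ?case
  proof (cases "\<exists>k c. (k, c) \<in> E \<and> k \<in> VT \<and> c \<notin> FT")
    case True
    then obtain k c where kc: "(k, c) \<in> E" "k \<in> VT" "c \<notin> FT" by blast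
    \<comment> \<open>Acyclicity enters here: a connected subgraph without \<open>c\<close> contains
      at most one neighbour of \<open>c\<close>.\<close>
    have int: "var_nbrs E c \<inter> VT = {k}"
      using acyclic_bip_unique_nbr[OF assms(1,3) less.prems(8), of c _ k] kc by auto
    let ?VT = "VT \<union> var_nbrs E c" and ?FT = "insert c FT"
    let ?r = "bip_adj V F E \<inter> (?VT <+> ?FT) \<times> (?VT <+> ?FT)"
    have "c \<in> F" using kc(1) assms(3) by blast
    have "sym ?r"
      using sym_bip_adj[of V F E] by (auto simp: sym_def)
    then have sym: "(y, x) \<in> ?r\<^sup>*" if "(x, y) \<in> ?r\<^sup>*" for x y
      using that by (meson symD sym_rtrancl)
    have old: "(x, y) \<in> ?r\<^sup>*" if "x \<in> ?W" "y \<in> ?W" for x y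
      using less.prems(8)[OF that] by (rule rtrancl_mono[THEN subsetD, rotated]) auto
    \<comment> \<open>The old nodes are linked to \<open>Inr c\<close> through \<open>k\<close> and
      the new variables directly, so the enlarged subgraph is connected again.\<close>
    have base: "(Inr c, x) \<in> ?r\<^sup>*" if x: "x \<in> ?VT <+> ?FT" for x
    proof -
      consider "x \<in> ?W" | "x = Inr c" | j where "x = Inl j" "(j, c) \<in> E"
        using x by auto
      then show ?thesis
      proof cases
        case 1
        have "(Inr c, Inl k) \<in> ?r" using kc by auto
        moreover have "(Inl k, x) \<in> ?r\<^sup>*" using old[of "Inl k" x] 1 kc(2) by blast
        ultimately show ?thesis by (rule converse_rtrancl_into_rtrancl)
      next
        case 3
        then have "(Inr c, x) \<in> ?r" by auto
        then show ?thesis by blast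
      qed auto
    qed
    have "card (F - ?FT) < card (F - FT)"
      using \<open>c \<in> F\<close> kc(3) assms(5) by (intro psubset_card_mono) auto
    then have "partial_marginal E S f n R u w ?VT ?FT =
        (\<Sum>s\<in>PiE (V - R) S. \<Sum>t\<in>PiE (V - R) S.
          global_function F E f (override_on s u R) (override_on t w R))"
    proof (rule less.hyps)
      show "?VT \<subseteq> V" "?FT \<subseteq> F" "?VT <+> ?FT \<noteq> {}" "R \<subseteq> ?VT"
        using less.prems(1-4) assms(3) \<open>c \<in> F\<close> by auto
      show "var_nbrs E a \<subseteq> ?VT" if "a \<in> ?FT" for a
        using that less.prems(7)[of a] by auto
      show "(x, y) \<in> ?r\<^sup>*" if "x \<in> ?VT <+> ?FT" "y \<in> ?VT <+> ?FT" for x y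
        using sym[OF base[OF that(1)]] base[OF that(2)] by (rule rtrancl_trans)
    qed (use less.prems in auto)
    moreover have "finite FT" using less.prems(2) assms(5) finite_subset by blast
    ultimately show ?thesis
      using partial_marginal_step[OF finE _ eqs less.prems(4-7) kc(3,1) int] by simp
  next
    case False
    obtain x where x: "x \<in> ?W" using less.prems(3) by blast
    have "y \<in> ?W" if y: "y \<in> V <+> F" for y
    proof -
      have "x \<in> V <+> F" using x less.prems(1,2) by auto
      then have "(x, y) \<in> (bip_adj V F E)\<^sup>*"
        using connected_bip_reachable[OF assms(2)] y by blast
      then show ?thesis
      proof (induction rule: rtrancl_induct)
        \<comment> \<open>A walk starting in \<open>?W\<close> stays there: from variables because
          no boundary edge exists, from factors because \<open>VT\<close> contains all their
          neighbours.\<close>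
        case (step y z)
        then show ?case
          using False less.prems(7) by (cases y; cases z) auto
      qed (use x in simp)
    qed
    then have "VT = V" "FT = F" using less.prems(1,2) by auto
    moreover have no_bd: "{(k, c)\<in>E. k \<in> V \<and> c \<notin> F} = {}" using assms(3) by auto
    ultimately show ?thesis by (simp only: partial_marginal_def no_bd prod.empty mult_1_right)
  qed
qed

text \<open>The growth starts from \<open>j\<close> alone with \<open>R = {j}\<close>: there is
  nothing to sum over, no local function is present, and the boundary consists of all edges at
  \<open>j\<close>.\<close>

lemma variable_marginal:
  assumes "acyclic_bip V F E" "connected_bip V F E" "E \<subseteq> V \<times> F" "finite V" "finite F"
    and "message_equations E S f m n" "j \<in> V" "x \<in> S j" "y \<in> S j"
  shows "(\<Sum>s\<in>PiE (V - {j}) S. \<Sum>t\<in>PiE (V - {j}) S.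
      global_function F E f (s(j := x)) (t(j := y))) = (\<Prod>c\<in>fac_nbrs E j. n (j, c) (x, y))"
proof -
  have upd: "override_on s (\<lambda>_. z) {j} = s(j := z)" for s :: "'a \<Rightarrow> 'c" and z
    by (auto simp: override_on_def)
  have "partial_marginal E S f n {j} (\<lambda>_. x) (\<lambda>_. y) {j} {} =
      (\<Sum>s\<in>PiE (V - {j}) S. \<Sum>t\<in>PiE (V - {j}) S.
        global_function F E f (s(j := x)) (t(j := y)))"
    unfolding upd[symmetric] using assms(7-9)
    by (intro partial_marginal_eq_marginal[OF assms(1-6)]) auto
  moreover have "(\<Prod>(k, c)\<in>{(k, c)\<in>E. k = j}. n (k, c) (x, y)) =
      (\<Prod>c\<in>fac_nbrs E j. n (j, c) (x, y))"
    by (rule prod.reindex_bij_witness[where i = "Pair j" and j = snd]) auto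
  ultimately show ?thesis
    by (simp add: partial_marginal_def global_function_def override_on_def split_def cong: conj_cong)
qed

text \<open>The growth starts from \<open>a\<close> with its neighbours, all in \<open>R\<close>. At
  each neighbour \<open>k\<close> the messages from factors other than \<open>a\<close> multiply to
  \<open>m (k, a)\<close>.\<close>

lemma factor_marginal:
  assumes "acyclic_bip V F E" "connected_bip V F E" "E \<subseteq> V \<times> F" "finite V" "finite F"
    and eqs: "message_equations E S f m n" and "a \<in> F"
    and u: "u \<in> PiE (var_nbrs E a) S" and w: "w \<in> PiE (var_nbrs E a) S"
  shows "(\<Sum>s\<in>PiE (V - var_nbrs E a) S. \<Sum>t\<in>PiE (V - var_nbrs E a) S.
      global_function F E f (override_on s u (var_nbrs E a)) (override_on t w (var_nbrs E a))) =
    f a u w * (\<Prod>j\<in>var_nbrs E a. m (j, a) (u j, w j))"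
proof -
  let ?R = "var_nbrs E a"
  let ?r = "bip_adj V F E \<inter> (?R <+> {a}) \<times> (?R <+> {a})"
  have "sym ?r"
    using sym_bip_adj[of V F E] by (auto simp: sym_def)
  then have sym: "(y, x) \<in> ?r\<^sup>*" if "(x, y) \<in> ?r\<^sup>*" for x y
    using that by (meson symD sym_rtrancl)
  have base: "(Inr a, x) \<in> ?r\<^sup>*" if "x \<in> ?R <+> {a}" for x
    using that by auto
  have con: "(x, y) \<in> ?r\<^sup>*" if "x \<in> ?R <+> {a}" "y \<in> ?R <+> {a}" for x y
    using sym[OF base[OF that(1)]] base[OF that(2)] by (rule rtrancl_trans)
  have "finite E" using assms(3-5) finite_subset by blast
  then have fin: "finite ?R" "finite (fac_nbrs E k)" for k
    by (rule finite_surj[of _ _ fst], force, rule finite_surj[of _ _ snd], force)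
  have "{(k, c)\<in>E. k \<in> ?R \<and> c \<notin> {a}} = Sigma ?R (\<lambda>k. fac_nbrs E k - {a})" by auto
  then have "(\<Prod>(k, c)\<in>{(k, c)\<in>E. k \<in> ?R \<and> c \<notin> {a}}. n (k, c) (u k, w k)) =
      (\<Prod>k\<in>?R. \<Prod>c\<in>fac_nbrs E k - {a}. n (k, c) (u k, w k))"
    using fin by (simp add: prod.Sigma)
  also have "\<dots> = (\<Prod>k\<in>?R. m (k, a) (u k, w k))"
    using message_equationsD(1)[OF eqs] u w by (intro prod.cong refl) (auto simp: PiE_iff)
  finally have bd: "(\<Prod>(k, c)\<in>{(k, c)\<in>E. k \<in> ?R \<and> c \<notin> {a}}. n (k, c) (u k, w k)) =
      (\<Prod>k\<in>?R. m (k, a) (u k, w k))" .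
  have "partial_marginal E S f n ?R u w ?R {a} =
      (\<Sum>s\<in>PiE (V - ?R) S. \<Sum>t\<in>PiE (V - ?R) S.
        global_function F E f (override_on s u ?R) (override_on t w ?R))"
    using con u w assms(3,7)
    by (intro partial_marginal_eq_marginal[OF assms(1-6)]) (auto simp: PiE_iff)
  \<comment> \<open>With every variable of the star in \<open>R\<close>, the only configuration
    summed over is the one on the empty set, which is \<open>undefined\<close> everywhere.\<close>
  moreover have "override_on (\<lambda>x. undefined) v ?R = v" if "v \<in> PiE ?R S" for v
    using that by (auto simp: override_on_def PiE_iff extensional_def)
  ultimately show ?thesis
    using bd u w by (simp add: partial_marginal_def global_function_def PiE_restrict)
qed

theorem theorem2p14:
  fixes V :: "'v set" and F :: "'f set" and E :: "('v \<times> 'f) set"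
    and S :: "'v \<Rightarrow> 'a set"
    and f :: "'f \<Rightarrow> ('v \<Rightarrow> 'a) \<Rightarrow> ('v \<Rightarrow> 'a) \<Rightarrow> complex"
  assumes "double_edge_factor_graph V F E S f"
    and "acyclic_bip V F E"
  shows "(\<exists>!(m, n). m \<in> message_families E S \<and> n \<in> message_families E S \<and>
            message_equations E S f m n) \<and>
    (\<forall>m n. m \<in> message_families E S \<longrightarrow> n \<in> message_families E S \<longrightarrow>
       message_equations E S f m n \<longrightarrow> connected_bip V F E \<longrightarrow>
         (\<forall>j\<in>V. \<forall>x\<in>S j. \<forall>y\<in>S j.
            (\<Sum>s\<in>PiE (V - {j}) S. \<Sum>t\<in>PiE (V - {j}) S.
               global_function F E f (s(j := x)) (t(j := y))) =
            (\<Prod>c\<in>fac_nbrs E j. n (j, c) (x, y))) \<and>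
         (\<forall>a\<in>F. \<forall>u\<in>PiE (var_nbrs E a) S. \<forall>w\<in>PiE (var_nbrs E a) S.
            (\<Sum>s\<in>PiE (V - var_nbrs E a) S. \<Sum>t\<in>PiE (V - var_nbrs E a) S.
               global_function F E f (override_on s u (var_nbrs E a))
                 (override_on t w (var_nbrs E a))) =
            f a u w * (\<Prod>j\<in>var_nbrs E a. m (j, a) (u j, w j))))"
proof -
  interpret double_edge_factor_graph V F E S f by fact
  have wf: "wf (message_dep (bip_adj V F E))"
    using assms(2) edges finite_V finite_F by (rule wf_message_dep)
  obtain m n where mn: "m \<in> message_families E S" "n \<in> message_families E S"
    "message_equations E S f m n"
    by (rule messages_exist[OF wf])
  have "\<exists>!(m, n). m \<in> message_families E S \<and> n \<in> message_families E S \<and>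
      message_equations E S f m n"
  proof (rule ex1I[of _ "(m, n)"])
    fix p assume "case p of (m, n) \<Rightarrow> m \<in> message_families E S \<and> n \<in> message_families E S \<and>
      message_equations E S f m n"
    then show "p = (m, n)" using messages_unique[OF wf _ _ _ mn] by (cases p) auto
  qed (use mn in simp)
  moreover note variable_marginal[OF assms(2) _ edges finite_V finite_F]
    factor_marginal[OF assms(2) _ edges finite_V finite_F]
  ultimately show ?thesis by (intro conjI allI impI ballI)
qed

end
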